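(* Let $f\in\mathbb{C}[z_1,\ldots,z_n]$ have the half-plane property. Then $\operatorname{supp}(f)\subseteq\mathbb{N}^n$ is a jump system.
   Context: For an open half-plane $H\subset\mathbb{C}$ whose boundary contains the origin, a polynomial $f\in\mathbb{C}[z_1,\ldots,z_n]$ is called $H$-stable if $f(z_1,\ldots,z_n)\neq 0$ whenever $z_1,\ldots,z_n\in H$; $f$ has the half-plane property if it is $H$-stable for some such $H$. For $\alpha\in\mathbb{N}^n$ write $z^\alpha=z_1^{\alpha_1}\cdots z_n^{\alpha_n}$. If $f=\sum_\alpha a(\alpha)z^\alpha$, its support is $\operatorname{supp}(f)=\{\alpha\in\mathbb{N}^n: a(\alpha)\neq 0\}$. For $\alpha\in\mathbb{Z}^n$ let $|\alpha|=\sum_i|\alpha_i|$. For $\alpha,\beta\in\mathbb{Z}^n$ the set of steps from $\alpha$ to $\beta$ is $\mathrm{St}(\alpha,\beta)=\{\sigma\in\mathbb{Z}^n: |\sigma|=1,\ |\alpha+\sigma-\beta|=|\alpha-\beta|-1\}$. A set $\mathcal{F}\subseteq\mathbb{Z}^n$ is a jump system if it satisfies the two-step axiom: whenever $\alpha,\beta\in\mathcal{F}$, $\sigma\in\mathrm{St}(\alpha,\beta)$ and $\alpha+\sigma\notin\mathcal{F}$, there exists $\tau\in\mathrm{St}(\alpha+\sigma,\beta)$ with $\alpha+\sigma+\tau\in\mathcal{F}$. *)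

theory Defs
  imports "HOL-Analysis.Analysis" "HOL-Library.Poly_Mapping"
begin

text \<open>
  Polynomials in the variables \<open>z\<^sub>i\<close> (\<open>i :: 'n\<close>) with complex coefficients are finitely supported
  maps from exponent vectors to coefficients; \<open>Poly_Mapping.lookup f \<alpha>\<close> is the coefficient of \<open>z\<^sup>\<alpha>\<close>
  and \<open>Poly_Mapping.keys f\<close> is the support of \<open>f\<close>.
\<close>

type_synonym 'n cpoly = "(nat ^ 'n) \<Rightarrow>\<^sub>0 complex"

definition monomial_eval :: "complex ^ 'n \<Rightarrow> nat ^ 'n \<Rightarrow> complex" where
  "monomial_eval z \<alpha> = (\<Prod>i\<in>UNIV. (z $ i) ^ (\<alpha> $ i))"

definition poly_eval :: "'n::finite cpoly \<Rightarrow> complex ^ 'n \<Rightarrow> complex" where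
  "poly_eval f z = (\<Sum>\<alpha>\<in>Poly_Mapping.keys f. Poly_Mapping.lookup f \<alpha> * monomial_eval z \<alpha>)"

definition open_half_plane :: "complex set \<Rightarrow> bool" where
  "open_half_plane H \<longleftrightarrow> (\<exists>a b. a \<noteq> 0 \<and> H = {z. inner a z < b})"

definition H_stable :: "complex set \<Rightarrow> 'n::finite cpoly \<Rightarrow> bool" where
  "H_stable H f \<longleftrightarrow> (\<forall>z. (\<forall>i. z $ i \<in> H) \<longrightarrow> poly_eval f z \<noteq> 0)"

definition half_plane_property :: "'n::finite cpoly \<Rightarrow> bool" where
  "half_plane_property f \<longleftrightarrow>
     (\<exists>H. open_half_plane H \<and> 0 \<in> frontier H \<and> H_stable H f)"

definition l1_norm :: "int ^ 'n \<Rightarrow> int" where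
  "l1_norm \<alpha> = (\<Sum>i\<in>UNIV. \<bar>\<alpha> $ i\<bar>)"

definition steps :: "int ^ 'n \<Rightarrow> int ^ 'n \<Rightarrow> (int ^ 'n) set" where
  "steps \<alpha> \<beta> = {\<sigma>. l1_norm \<sigma> = 1 \<and> l1_norm (\<alpha> + \<sigma> - \<beta>) = l1_norm (\<alpha> - \<beta>) - 1}"

definition jump_system :: "(int ^ 'n) set \<Rightarrow> bool" where
  "jump_system F \<longleftrightarrow>
     (\<forall>\<alpha>\<in>F. \<forall>\<beta>\<in>F. \<forall>\<sigma>\<in>steps \<alpha> \<beta>. \<alpha> + \<sigma> \<notin> F \<longrightarrow>
        (\<exists>\<tau>\<in>steps (\<alpha> + \<sigma>) \<beta>. \<alpha> + \<sigma> + \<tau> \<in> F))"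

definition int_vec :: "nat ^ 'n \<Rightarrow> int ^ 'n" where
  "int_vec \<alpha> = (\<chi> i. int (\<alpha> $ i))"

end

theory Submission
  imports Defs "HOL-Computational_Algebra.Fundamental_Theorem_Algebra"
begin

text \<open>
  After a rotation the half-plane is the upper one. Then \<open>\<partial>\<^sub>i f / f\<close> has nonpositive imaginary part on
  the product of upper half-planes, since in one variable it is a sum of terms \<open>1 / (w - r)\<close> with
  \<open>Im r \<le> 0\<close>. If \<open>\<partial>\<^sub>i f\<close> had a zero there, the quotient would, along every complex line through that
  zero, vanish or take values with positive imaginary part; hence \<open>\<partial>\<^sub>i f\<close> is zero or stable again.
  Differentiating and substituting \<open>z\<^sub>i \<mapsto> - 1 / z\<^sub>i\<close> therefore allows one to cut the support down to
  the box spanned by \<open>\<alpha>\<close> and \<open>\<beta>\<close>, placed so that \<open>\<alpha> = 0\<close>. If the two-step axiom failed at \<open>0\<close>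
  for the step \<open>e\<^sub>p\<close>, then \<open>\<partial>\<^sub>p f\<close> would have no terms of degree below 2. For positive \<open>v\<close> the function
  \<open>t \<mapsto> (\<partial>\<^sub>p f / f) (t v)\<close> would then vanish to order at least 2 at \<open>0\<close>, while it maps the upper half-plane
  into the closed lower one. A leading term \<open>c t\<^sup>k\<close> with \<open>k \<ge> 2\<close> winds the upper half-plane around too
  far for that, so \<open>\<partial>\<^sub>p f = 0\<close>, contradicting that \<open>z\<^sup>\<beta>\<close> occurs in \<open>f\<close>.
\<close>

section \<open>Polynomials as coefficient functions: evaluation, slices, derivatives\<close>

text \<open>Exponents are functions here instead of vectors, so that changing one exponent is a
  function update.\<close>

definition mpeval :: "(('n::finite \<Rightarrow> nat) \<Rightarrow> complex) \<Rightarrow> ('n \<Rightarrow> complex) \<Rightarrow> complex" where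
  "mpeval a z = (\<Sum>\<gamma> | a \<gamma> \<noteq> 0. a \<gamma> * (\<Prod>i\<in>UNIV. z i ^ \<gamma> i))"

lemma mpeval_superset:
  assumes "finite S" "\<And>\<gamma>. a \<gamma> \<noteq> 0 \<Longrightarrow> \<gamma> \<in> S"
  shows "mpeval a z = (\<Sum>\<gamma>\<in>S. a \<gamma> * (\<Prod>i\<in>UNIV. z i ^ \<gamma> i))"
  unfolding mpeval_def by (rule sum.mono_neutral_left) (use assms in auto)

lemma prod_fun_upd_power:
  fixes z :: "'n::finite \<Rightarrow> complex"
  shows "(\<Prod>j\<in>UNIV. (z(i := w)) j ^ \<gamma> j) = w ^ \<gamma> i * (\<Prod>j\<in>-{i}. z j ^ \<gamma> j)"
proof -
  have "(\<Prod>j\<in>UNIV. (z(i := w)) j ^ \<gamma> j)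
      = (z(i := w)) i ^ \<gamma> i * (\<Prod>j\<in>UNIV - {i}. (z(i := w)) j ^ \<gamma> j)"
    by (rule prod.remove) auto
  also have "(\<Prod>j\<in>UNIV - {i}. (z(i := w)) j ^ \<gamma> j) = (\<Prod>j\<in>-{i}. z j ^ \<gamma> j)"
    by (rule prod.cong) auto
  finally show ?thesis by simp
qed

text \<open>Only the variable \<open>i\<close> is left free, and the entry \<open>z i\<close> is
  ignored. Passing to \<open>complex poly\<close> gives access to root counting,
  \<open>pderiv\<close> and the fundamental theorem of algebra.\<close>

definition slice :: "(('n::finite \<Rightarrow> nat) \<Rightarrow> complex) \<Rightarrow> ('n \<Rightarrow> complex) \<Rightarrow> 'n \<Rightarrow> complex poly" where
  "slice a z i = (\<Sum>\<gamma> | a \<gamma> \<noteq> 0. monom (a \<gamma> * (\<Prod>j\<in>-{i}. z j ^ \<gamma> j)) (\<gamma> i))"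

lemma poly_slice: "poly (slice a z i) w = mpeval a (z(i := w))"
  unfolding slice_def mpeval_def prod_fun_upd_power
  by (simp add: poly_sum poly_monom mult_ac)

text \<open>The coefficients of the partial derivative with respect to the variable \<open>i\<close>.\<close>

definition shift_deriv :: "'n::finite \<Rightarrow> (('n \<Rightarrow> nat) \<Rightarrow> complex) \<Rightarrow> ('n \<Rightarrow> nat) \<Rightarrow> complex" where
  "shift_deriv i a \<gamma> = of_nat (Suc (\<gamma> i)) * a (\<gamma>(i := Suc (\<gamma> i)))"

lemma shift_deriv_eq_0_iff: "shift_deriv i a \<gamma> = 0 \<longleftrightarrow> a (\<gamma>(i := Suc (\<gamma> i))) = 0"
  by (simp add: shift_deriv_def del: of_nat_Suc)

lemma finite_support_shift_deriv:
  assumes "finite {\<gamma>. a \<gamma> \<noteq> 0}"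
  shows "finite {\<gamma>. shift_deriv i a \<gamma> \<noteq> 0}"
proof (rule finite_subset)
  show "{\<gamma>. shift_deriv i a \<gamma> \<noteq> 0} \<subseteq> (\<lambda>\<gamma>. \<gamma>(i := \<gamma> i - 1)) ` {\<gamma>. a \<gamma> \<noteq> 0}"
  proof
    fix \<gamma> assume "\<gamma> \<in> {\<gamma>. shift_deriv i a \<gamma> \<noteq> 0}"
    then have "\<gamma>(i := Suc (\<gamma> i)) \<in> {\<gamma>. a \<gamma> \<noteq> 0}" by (simp add: shift_deriv_eq_0_iff)
    then show "\<gamma> \<in> (\<lambda>\<gamma>. \<gamma>(i := \<gamma> i - 1)) ` {\<gamma>. a \<gamma> \<noteq> 0}"
      by (rule image_eqI[rotated]) simp
  qed
qed (use assms in simp)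

lemma poly_pderiv_slice:
  assumes "finite {\<gamma>. a \<gamma> \<noteq> 0}"
  shows "poly (pderiv (slice a z i)) w = mpeval (shift_deriv i a) (z(i := w))"
proof -
  have "poly (pderiv (slice a z i)) w
     = (\<Sum>\<gamma> | a \<gamma> \<noteq> 0. of_nat (\<gamma> i) * a \<gamma> * (\<Prod>j\<in>-{i}. z j ^ \<gamma> j) * w ^ (\<gamma> i - 1))"
    unfolding slice_def by (simp add: higher_pderiv_sum [of 1, simplified] pderiv_monom poly_sum poly_monom mult_ac)
  \<comment> \<open>Terms with \<open>\<gamma> i = 0\<close> have coefficient 0 and must go before
    reindexing, since lowering the exponent is invertible only on the others.\<close>
  also have "\<dots> = (\<Sum>\<gamma> | a \<gamma> \<noteq> 0 \<and> \<gamma> i \<noteq> 0.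
       of_nat (\<gamma> i) * a \<gamma> * (\<Prod>j\<in>-{i}. z j ^ \<gamma> j) * w ^ (\<gamma> i - 1))"
    by (rule sum.mono_neutral_right) (use assms in auto)
  also have "\<dots> = (\<Sum>\<gamma> | shift_deriv i a \<gamma> \<noteq> 0.
       shift_deriv i a \<gamma> * (\<Prod>j\<in>UNIV. (z(i := w)) j ^ \<gamma> j))"
    unfolding prod_fun_upd_power
  proof (rule sum.reindex_bij_witness[where i = "\<lambda>\<gamma>. \<gamma>(i := Suc (\<gamma> i))" and j = "\<lambda>\<gamma>. \<gamma>(i := \<gamma> i - 1)"])
    fix \<gamma> assume *: "\<gamma> \<in> {\<gamma>. a \<gamma> \<noteq> 0 \<and> \<gamma> i \<noteq> 0}"
    then show "(\<gamma>(i := \<gamma> i - 1))(i := Suc ((\<gamma>(i := \<gamma> i - 1)) i)) = \<gamma>" by simp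
    then show "\<gamma>(i := \<gamma> i - 1) \<in> {\<gamma>. shift_deriv i a \<gamma> \<noteq> 0}"
      using * by (simp add: shift_deriv_eq_0_iff)
    have "(\<Prod>j\<in>-{i}. z j ^ (\<gamma>(i := \<gamma> i - 1)) j) = (\<Prod>j\<in>-{i}. z j ^ \<gamma> j)"
      by (rule prod.cong) auto
    then show "shift_deriv i a (\<gamma>(i := \<gamma> i - 1)) * (w ^ (\<gamma>(i := \<gamma> i - 1)) i *
        (\<Prod>j\<in>-{i}. z j ^ (\<gamma>(i := \<gamma> i - 1)) j))
        = of_nat (\<gamma> i) * a \<gamma> * (\<Prod>j\<in>-{i}. z j ^ \<gamma> j) * w ^ (\<gamma> i - 1)"
      using * by (simp add: shift_deriv_def mult_ac del: of_nat_Suc)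
  qed (auto simp: shift_deriv_eq_0_iff)
  finally show ?thesis by (simp add: mpeval_def)
qed

lemma mpeval_line_poly:
  "\<exists>P. \<forall>t. poly P t = mpeval a (\<lambda>i. x i + t * y i)"
proof (intro exI allI)
  fix t
  show "poly (\<Sum>\<gamma> | a \<gamma> \<noteq> 0. smult (a \<gamma>) (\<Prod>i\<in>UNIV. [:x i, y i:] ^ \<gamma> i)) t
      = mpeval a (\<lambda>i. x i + t * y i)"
    by (simp add: mpeval_def poly_sum poly_prod)
qed

text \<open>The slice in direction \<open>i\<close> has all of \<open>X\<close> among its roots, so
  it is the zero polynomial and each of its coefficients vanishes.\<close>

lemma mpeval_restrict_eq_0:
  assumes fin: "finite {\<gamma>. a \<gamma> \<noteq> 0}" and X: "infinite X"
    and vanish: "\<And>z. (\<And>i. z i \<in> X) \<Longrightarrow> mpeval a z = 0"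
    and z: "\<And>i. z i \<in> X"
  shows "mpeval (\<lambda>\<gamma>. if \<gamma> i = k then a \<gamma> else 0) z = 0"
proof -
  have "poly (slice a z i) w = 0" if "w \<in> X" for w
    unfolding poly_slice by (rule vanish) (use z that in auto)
  then have "X \<subseteq> {w. poly (slice a z i) w = 0}" by auto
  then have "slice a z i = 0"
    using X poly_roots_finite finite_subset by blast
  \<comment> \<open>The factor \<open>z i ^ k\<close> restores the power of \<open>z i\<close> that
    the coefficient of the slice lacks, which makes the sum a multivariate evaluation again.\<close>
  then have "0 = z i ^ k * coeff (slice a z i) k" by simp
  also have "\<dots> = (\<Sum>\<gamma> | a \<gamma> \<noteq> 0. if \<gamma> i = k
      then a \<gamma> * (z i ^ \<gamma> i * (\<Prod>j\<in>-{i}. z j ^ \<gamma> j)) else 0)"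
    unfolding slice_def coeff_sum sum_distrib_left by (rule sum.cong) (auto simp: mult_ac)
  also have "\<dots> = (\<Sum>\<gamma> | a \<gamma> \<noteq> 0. (if \<gamma> i = k then a \<gamma> else 0) * (\<Prod>j\<in>UNIV. z j ^ \<gamma> j))"
    using prod_fun_upd_power[of z i "z i"] by (intro sum.cong) auto
  also have "\<dots> = mpeval (\<lambda>\<gamma>. if \<gamma> i = k then a \<gamma> else 0) z"
    by (rule mpeval_superset[symmetric]) (use fin in \<open>auto split: if_splits\<close>)
  finally show ?thesis by simp
qed

text \<open>The exponents are fixed to those of \<open>\<delta>\<close> one coordinate at a time. In
  the end a single monomial is left, and \<open>0 \<notin> X\<close> allows its value to be
  cancelled.\<close>

lemma mpeval_zero_imp_coeff_zero:
  fixes a :: "('n::finite \<Rightarrow> nat) \<Rightarrow> complex"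
  assumes fin: "finite {\<gamma>. a \<gamma> \<noteq> 0}" and X: "infinite X" "0 \<notin> X"
    and vanish: "\<And>z. (\<And>i. z i \<in> X) \<Longrightarrow> mpeval a z = 0"
  shows "a \<delta> = 0"
proof -
  have *: "mpeval (\<lambda>\<gamma>. if \<forall>i\<in>A. \<gamma> i = \<delta> i then a \<gamma> else 0) z = 0"
    if "finite A" "\<And>i. z i \<in> X" for A z
    using that
  proof (induction A arbitrary: z rule: finite_induct)
    case empty
    then show ?case using vanish by simp
  next
    case (insert p A)
    have eq: "(\<lambda>\<gamma>. if \<forall>i\<in>insert p A. \<gamma> i = \<delta> i then a \<gamma> else 0)
        = (\<lambda>\<gamma>. if \<gamma> p = \<delta> p then (if \<forall>i\<in>A. \<gamma> i = \<delta> i then a \<gamma> else 0) else 0)" by auto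
    show ?case
      unfolding eq
    proof (rule mpeval_restrict_eq_0[OF _ X(1)])
      show "finite {\<gamma>. (if \<forall>i\<in>A. \<gamma> i = \<delta> i then a \<gamma> else 0) \<noteq> 0}"
        by (rule finite_subset[OF _ fin]) auto
    qed (use insert in auto)
  qed
  obtain x where x: "x \<in> X" using X(1) by fastforce
  have "0 = mpeval (\<lambda>\<gamma>. if \<forall>i\<in>UNIV. \<gamma> i = \<delta> i then a \<gamma> else 0) (\<lambda>_. x)"
    using *[of UNIV "\<lambda>_. x"] x by simp
  also have "\<dots> = (\<Sum>\<gamma>\<in>{\<delta>}. (if \<forall>i\<in>UNIV. \<gamma> i = \<delta> i then a \<gamma> else 0) * (\<Prod>i\<in>UNIV. x ^ \<gamma> i))"
    by (rule mpeval_superset) (auto simp: fun_eq_iff split: if_splits)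
  also have "\<dots> = a \<delta> * (\<Prod>i\<in>UNIV. x ^ \<delta> i)" by simp
  finally show ?thesis using x X(2) by (auto simp: prod_zero_iff)
qed

section \<open>Logarithmic derivatives and stability of partial derivatives\<close>

definition stable :: "(('n::finite \<Rightarrow> nat) \<Rightarrow> complex) \<Rightarrow> bool" where
  "stable a \<longleftrightarrow> finite {\<gamma>. a \<gamma> \<noteq> 0} \<and> (\<forall>z. (\<forall>i. Im (z i) > 0) \<longrightarrow> mpeval a z \<noteq> 0)"

text \<open>Induction on the degree: splitting off a root \<open>r\<close> adds
  \<open>1 / (w - r)\<close> to the logarithmic derivative, and the cofactor again has no zero in
  the upper half-plane.\<close>

lemma Im_logderiv_le_0:
  fixes p :: "complex poly"
  assumes "\<And>w. Im w > 0 \<Longrightarrow> poly p w \<noteq> 0" "Im w > 0"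
  shows "Im (poly (pderiv p) w / poly p w) \<le> 0"
  using assms(1)
proof (induction "degree p" arbitrary: p)
  case 0
  then have "pderiv p = 0" by (simp add: pderiv_eq_0_iff)
  then show ?case by simp
next
  case (Suc n)
  then have "\<not> constant (poly p)" by (simp add: constant_degree)
  then obtain r where r: "poly p r = 0" using fundamental_theorem_of_algebra by blast
  then obtain q where q: "p = [:- r, 1:] * q" by (auto simp: poly_eq_0_iff_dvd)
  have "q \<noteq> 0" using q Suc.hyps(2) by auto
  then have deg: "degree p = Suc (degree q)" unfolding q by (subst degree_mult_eq) auto
  have nz: "poly q u \<noteq> 0" if "Im u > 0" for u
    using Suc.prems[OF that] unfolding q by auto
  have IH: "Im (poly (pderiv q) w / poly q w) \<le> 0"
    using Suc.hyps deg nz by (metis Suc_inject)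
  have "Im r \<le> 0" using Suc.prems r by force
  then have wr: "w - r \<noteq> 0" "Im (w - r) > 0" using assms(2) by auto
  have "poly (pderiv p) w / poly p w = 1 / (w - r) + poly (pderiv q) w / poly q w"
    unfolding q pderiv_mult using wr(1) nz[OF assms(2)]
    by (simp add: pderiv_pCons field_simps)
  moreover have "Im (1 / (w - r)) \<le> 0"
    using wr by (simp add: Im_divide divide_nonpos_nonneg)
  ultimately show ?case using IH by simp
qed

lemma stable_Im_shift_deriv:
  assumes "stable a" "\<And>i. Im (z i) > 0"
  shows "Im (mpeval (shift_deriv i a) z / mpeval a z) \<le> 0"
proof -
  have "Im (poly (pderiv (slice a z i)) (z i) / poly (slice a z i) (z i)) \<le> 0"
    by (rule Im_logderiv_le_0) (use assms in \<open>auto simp: poly_slice stable_def\<close>)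
  then show ?thesis
    using assms(1) by (simp add: poly_slice poly_pderiv_slice stable_def)
qed

text \<open>At \<open>of_real e * u\<close> the quotient is \<open>e ^ k\<close> times a quantity
  tending to the leading coefficient times \<open>u ^ k\<close>. The positive factor does not affect
  the sign of the imaginary part, and the weak inequality survives the limit.\<close>

lemma leading_term_Im_le_0:
  fixes A B :: "complex poly"
  assumes A: "poly A 0 \<noteq> 0"
    and Im: "eventually (\<lambda>e::real. Im (poly (monom 1 k * B) (of_real e * u) / poly A (of_real e * u)) \<le> 0) (at_right 0)"
  shows "Im (poly B 0 / poly A 0 * u ^ k) \<le> 0"
proof (rule tendsto_upperbound)
  have *: "((\<lambda>e. poly Q (of_real e * u)) \<longlongrightarrow> poly Q 0) (at_right 0)" for Q :: "complex poly"
  proof -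
    have "((\<lambda>e. poly Q (of_real e * u)) \<longlongrightarrow> poly Q (of_real 0 * u)) (at_right 0)"
      by (intro tendsto_intros)
    then show ?thesis by simp
  qed
  show "((\<lambda>e. Im (poly B (of_real e * u) / poly A (of_real e * u) * u ^ k)) \<longlongrightarrow>
      Im (poly B 0 / poly A 0 * u ^ k)) (at_right 0)"
    by (intro tendsto_intros * A)
  show "eventually (\<lambda>e. Im (poly B (of_real e * u) / poly A (of_real e * u) * u ^ k) \<le> 0) (at_right 0)"
    using Im eventually_at_right_less[of 0]
  proof eventually_elim
    case (elim e)
    have "poly (monom 1 k * B) (of_real e * u) / poly A (of_real e * u)
       = of_real (e ^ k) * (poly B (of_real e * u) / poly A (of_real e * u) * u ^ k)"
      by (simp add: poly_monom power_mult_distrib)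
    moreover have "Im (of_real x * y) = x * Im y" for x y by simp
    ultimately have "e ^ k * Im (poly B (of_real e * u) / poly A (of_real e * u) * u ^ k) \<le> 0"
      using elim(1) by (simp only:)
    then show ?case using elim(2) by (metis mult_le_cancel_left_pos mult_zero_right zero_less_power)
  qed
qed simp

text \<open>With \<open>u = cis \<theta>\<close> the argument of \<open>c * u ^ k\<close> is
  \<open>Arg c + k * \<theta>\<close>. It has to hit an angle with positive sine while
  \<open>k * \<theta>\<close> stays below \<open>2 * pi\<close>, so that
  \<open>\<theta> < pi\<close> once \<open>k \<ge> 2\<close>.\<close>

lemma exists_direction_Im_pos:
  fixes c :: complex
  assumes c: "c \<noteq> 0" and k: "k \<noteq> 0"
  obtains u where "Im (c * u ^ k) > 0" "k \<ge> 2 \<Longrightarrow> Im u > 0"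
proof -
  note direction = that
  have *: thesis if th: "\<theta> > 0" "k \<ge> 2 \<Longrightarrow> \<theta> < pi" and sin: "sin (Arg c + real k * \<theta>) > 0" for \<theta>
  proof (rule direction)
    have "c * cis \<theta> ^ k = of_real (cmod c) * cis (Arg c + real k * \<theta>)"
      using c by (simp add: Complex.DeMoivre cis_mult[symmetric] rcis_cmod_Arg[unfolded rcis_def] mult.assoc[symmetric])
    then show "Im (c * cis \<theta> ^ k) > 0" using c sin by simp
    show "Im (cis \<theta>) > 0" if "k \<ge> 2" using th that by (simp add: sin_gt_zero)
  qed
  have Arg: "- pi < Arg c" "Arg c \<le> pi" using Arg_bounded[of c] by auto
  have k2: "2 * pi \<le> real k * pi" if "k \<ge> 2" using that by simp
  show thesis
  proof (cases "Arg c < pi / 2")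
    case True
    show thesis
    proof (rule *[of "(pi / 2 - Arg c) / real k"])
      show "(pi / 2 - Arg c) / real k < pi" if "k \<ge> 2"
      proof -
        have "pi / 2 - Arg c < real k * pi" using k2[OF that] Arg pi_gt_zero by linarith
        then show ?thesis using k by (simp add: divide_less_eq mult.commute)
      qed
    qed (use True k in auto)
  next
    case False
    \<comment> \<open>Here the target lies one turn further. The angle \<open>pi / 2\<close> would
      not do: for \<open>Arg c = pi / 2\<close> and \<open>k = 2\<close> it gives
      \<open>\<theta> = pi\<close>, where \<open>u\<close> is real.\<close>
    have sin: "sin (pi / 4 + 2 * pi) > 0" unfolding sin_periodic sin_45 by simp
    show thesis
    proof (rule *[of "(pi / 4 + 2 * pi - Arg c) / real k"])
      show "(pi / 4 + 2 * pi - Arg c) / real k < pi" if "k \<ge> 2"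
      proof -
        have "pi / 4 + 2 * pi - Arg c < real k * pi" using k2[OF that] False pi_gt_zero by linarith
        then show ?thesis using k by (simp add: divide_less_eq mult.commute)
      qed
      show "(pi / 4 + 2 * pi - Arg c) / real k > 0" using Arg k by simp
      have "Arg c + real k * ((pi / 4 + 2 * pi - Arg c) / real k) = pi / 4 + 2 * pi"
        using k by simp
      then show "sin (Arg c + real k * ((pi / 4 + 2 * pi - Arg c) / real k)) > 0"
        using sin by (simp only:)
    qed
  qed
qed

lemma poly_factor_monom_at_0:
  fixes B :: "complex poly"
  assumes "B \<noteq> 0"
  obtains k C where "B = monom 1 k * C" "poly C 0 \<noteq> 0"
proof -
  from order_decomp[OF assms, of 0] obtain q
    where "B = [:-0, 1:] ^ order 0 B * q" "\<not> [:-0, 1:] dvd q" by blast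
  then show thesis
    using that by (auto simp: poly_eq_0_iff_dvd monom_altdef)
qed

text \<open>A zero \<open>x\<close> of the derivative is an interior point of the product of
  half-planes, so the direction \<open>u\<close> may be any complex number and vanishing to order
  \<open>k \<ge> 1\<close> already contradicts the sign of the quotient. Hence the derivative
  vanishes on every complex line through \<open>x\<close>.\<close>

lemma stable_shift_deriv:
  assumes st: "stable a" and nz: "shift_deriv i a \<delta> \<noteq> 0"
  shows "stable (shift_deriv i a)"
proof (rule ccontr)
  let ?b = "shift_deriv i a"
  have fin: "finite {\<gamma>. ?b \<gamma> \<noteq> 0}"
    using st finite_support_shift_deriv by (auto simp: stable_def)
  assume "\<not> stable ?b"
  then obtain x where x: "\<And>i. Im (x i) > 0" "mpeval ?b x = 0"
    using fin by (auto simp: stable_def)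
  have vanish: "mpeval ?b y = 0" for y
  proof -
    obtain A where A: "\<forall>t. poly A t = mpeval a (\<lambda>i. x i + t * (y i - x i))"
      using mpeval_line_poly[of a x "\<lambda>i. y i - x i"] ..
    obtain B where B: "\<forall>t. poly B t = mpeval ?b (\<lambda>i. x i + t * (y i - x i))"
      using mpeval_line_poly[of ?b x "\<lambda>i. y i - x i"] ..
    have "B = 0"
    proof (rule ccontr)
      assume "B \<noteq> 0"
      then obtain k C where C: "B = monom 1 k * C" "poly C 0 \<noteq> 0"
        by (rule poly_factor_monom_at_0)
      have A0: "poly A 0 \<noteq> 0" using st x by (simp add: A stable_def)
      have "poly B 0 = 0" using x by (simp add: B)
      then have "k \<noteq> 0" using C by (auto simp: poly_monom)
      then obtain u where u: "Im (poly C 0 / poly A 0 * u ^ k) > 0"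
        using exists_direction_Im_pos[of "poly C 0 / poly A 0" k] C A0 by auto
      have "\<forall>\<^sub>F e::real in at_right 0. Im (x i + of_real e * u * (y i - x i)) > 0" for i
      proof (rule order_tendstoD(1))
        have "((\<lambda>e::real. Im (x i + of_real e * u * (y i - x i))) \<longlongrightarrow>
            Im (x i + of_real 0 * u * (y i - x i))) (at_right 0)"
          by (intro tendsto_intros)
        then show "((\<lambda>e::real. Im (x i + of_real e * u * (y i - x i))) \<longlongrightarrow> Im (x i)) (at_right 0)"
          by simp
      qed (use x in simp)
      then have "\<forall>\<^sub>F e::real in at_right 0. \<forall>i. Im (x i + of_real e * u * (y i - x i)) > 0"
        by (simp add: eventually_all_finite)
      then have "\<forall>\<^sub>F e::real in at_right 0.
          Im (poly (monom 1 k * C) (of_real e * u) / poly A (of_real e * u)) \<le> 0"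
        unfolding C(1)[symmetric] A[rule_format] B[rule_format]
        by eventually_elim (rule stable_Im_shift_deriv[OF st], blast)
      then have "Im (poly C 0 / poly A 0 * u ^ k) \<le> 0"
        by (rule leading_term_Im_le_0[OF A0])
      with u show False by simp
    qed
    \<comment> \<open>The parameter 1 on the line from \<open>x\<close> gives the point
      \<open>y\<close>.\<close>
    then show ?thesis using B[rule_format, of 1] by simp
  qed
  have "infinite (-{0::complex})"
    using infinite_UNIV_char_0 by (simp add: finite_compl)
  then have "?b \<delta> = 0"
    by (rule mpeval_zero_imp_coeff_zero[OF fin]) (use vanish in auto)
  with nz show False ..
qed

section \<open>The two-step axiom at the origin\<close>

text \<open>The origin lies on the boundary of the half-planes, so only directions with
  \<open>Im u > 0\<close> are available. This calls for vanishing to order at least 2, which is what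
  the failure of the axiom provides.\<close>

lemma stable_exchange_from_0:
  assumes st: "stable a" and a0: "a (\<lambda>_. 0) \<noteq> 0" and m: "a m \<noteq> 0" "m p \<noteq> 0"
    and ap: "a ((\<lambda>_. 0)(p := 1)) = 0"
  shows "\<exists>j. a (((\<lambda>_. 0)(p := 1))(j := Suc (((\<lambda>_. 0)(p := 1)) j))) \<noteq> 0"
proof (rule ccontr)
  assume contra: "\<not> ?thesis"
  let ?b = "shift_deriv p a"
  have fina: "finite {\<gamma>. a \<gamma> \<noteq> 0}" using st by (simp add: stable_def)
  have fin: "finite {\<gamma>. ?b \<gamma> \<noteq> 0}" using fina by (rule finite_support_shift_deriv)
  have b0: "?b (\<lambda>_. 0) = 0" using ap by (simp add: shift_deriv_def)
  \<comment> \<open>The linear coefficient in direction \<open>j\<close> of the derivative stems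
    from the exponent \<open>e_p + e_j\<close>, which \<open>contra\<close> excludes.\<close>
  have b1: "?b ((\<lambda>_. 0)(j := 1)) = 0" for j
  proof -
    have "((\<lambda>_. 0)(j := 1))(p := Suc (((\<lambda>_. 0)(j := 1)) p))
       = ((\<lambda>_. 0)(p := 1))(j := Suc (((\<lambda>_. 0)(p := 1)) j))" by auto
    then show ?thesis using contra by (simp add: shift_deriv_eq_0_iff)
  qed
  have deg2: "(\<Sum>i\<in>UNIV. \<gamma> i) \<ge> 2" if "?b \<gamma> \<noteq> 0" for \<gamma>
  proof (rule ccontr)
    assume lt: "\<not> ?thesis"
    have "\<gamma> \<noteq> (\<lambda>_. 0)" using b0 that by auto
    then obtain j where j: "\<gamma> j \<noteq> 0" by auto
    have "(\<Sum>i\<in>UNIV. \<gamma> i) = \<gamma> j + (\<Sum>i\<in>UNIV - {j}. \<gamma> i)" by (rule sum.remove) auto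
    then have "\<gamma> j = 1" "(\<Sum>i\<in>UNIV - {j}. \<gamma> i) = 0" using lt j by linarith+
    then have "\<gamma> = (\<lambda>_. 0)(j := 1)" by (auto simp: fun_eq_iff)
    then show False using b1 that by simp
  qed
  \<comment> \<open>For positive real \<open>v\<close> the points \<open>t * v i\<close> stay in the
    upper half-plane along with \<open>t\<close>.\<close>
  have vanish: "mpeval ?b v = 0" if v: "\<And>i. v i \<in> of_real ` {0<..}" for v
  proof -
    have "\<exists>r. \<forall>i. v i = of_real (r i) \<and> r i > 0"
      using v by (intro choice) auto
    then obtain r where r: "\<And>i. v i = of_real (r i)" "\<And>i. r i > 0" by blast
    obtain A where A: "\<forall>t. poly A t = mpeval a (\<lambda>i. 0 + t * v i)"
      using mpeval_line_poly[of a "\<lambda>_. 0" v] ..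
    \<comment> \<open>Unlike \<open>A\<close>, this polynomial is written out by total degree, so
      that \<open>deg2\<close> can be read off its coefficients.\<close>
    define B where "B = (\<Sum>\<gamma> | ?b \<gamma> \<noteq> 0. monom (?b \<gamma> * (\<Prod>i\<in>UNIV. v i ^ \<gamma> i)) (\<Sum>i\<in>UNIV. \<gamma> i))"
    have B: "poly B t = mpeval ?b (\<lambda>i. t * v i)" for t
      unfolding B_def mpeval_def
      by (simp add: poly_sum poly_monom power_mult_distrib prod.distrib power_sum mult_ac)
    have "B = 0"
    proof (rule ccontr)
      assume "B \<noteq> 0"
      then obtain k C where C: "B = monom 1 k * C" "poly C 0 \<noteq> 0"
        by (rule poly_factor_monom_at_0)
      have "mpeval a (\<lambda>i. 0) = (\<Sum>\<gamma> | a \<gamma> \<noteq> 0. if \<gamma> = (\<lambda>_. 0) then a (\<lambda>_. 0) else 0)"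
      proof -
        have "(\<Prod>i\<in>UNIV. 0 ^ \<gamma> i) = (if \<gamma> = (\<lambda>_. 0) then 1 else 0 :: complex)" for \<gamma> :: "'a \<Rightarrow> nat"
          by (auto simp: power_0_left fun_eq_iff)
        then show ?thesis unfolding mpeval_def by (intro sum.cong) auto
      qed
      then have A0: "poly A 0 \<noteq> 0" using a0 fina by (simp add: A)
      have "coeff B n = 0" if "n < 2" for n
        unfolding B_def coeff_sum using deg2 that by (intro sum.neutral) fastforce
      moreover have "coeff B k \<noteq> 0"
        unfolding C(1) using C(2) by (simp add: coeff_monom_mult poly_0_coeff_0)
      ultimately have k: "k \<ge> 2" by (meson not_le)
      then obtain u where u: "Im (poly C 0 / poly A 0 * u ^ k) > 0" "Im u > 0"
        using exists_direction_Im_pos[of "poly C 0 / poly A 0" k] C A0 by auto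
      have "\<forall>\<^sub>F e::real in at_right 0. e > 0" by (rule eventually_at_right_less)
      then have "\<forall>\<^sub>F e::real in at_right 0.
          Im (poly (monom 1 k * C) (of_real e * u) / poly A (of_real e * u)) \<le> 0"
        unfolding C(1)[symmetric] A[rule_format] B
      proof eventually_elim
        case (elim e)
        have "Im (of_real e * u * v i) > 0" for i
          using elim u(2) r by simp
        then show ?case using stable_Im_shift_deriv[OF st] by simp
      qed
      then have "Im (poly C 0 / poly A 0 * u ^ k) \<le> 0"
        by (rule leading_term_Im_le_0[OF A0])
      with u show False by simp
    qed
    then show ?thesis using B[of 1] by simp
  qed
  have "infinite (complex_of_real ` {0<..})"
    by (simp add: finite_image_iff inj_on_def infinite_Ioi)
  \<comment> \<open>Up to a nonzero factor this coefficient of the derivative is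
    \<open>a m\<close>.\<close>
  then have "?b (m(p := m p - 1)) = 0"
    by (rule mpeval_zero_imp_coeff_zero[OF fin]) (use vanish in auto)
  then show False using m by (simp add: shift_deriv_eq_0_iff)
qed

section \<open>Reflection of one variable\<close>

text \<open>The coefficients of \<open>z\<^sub>i\<^sup>d f(\<dots>, - 1 / z\<^sub>i, \<dots>)\<close>, provided \<open>f\<close> has degree at most \<open>d\<close> in \<open>z\<^sub>i\<close>.\<close>

definition reflect :: "'n::finite \<Rightarrow> nat \<Rightarrow> (('n \<Rightarrow> nat) \<Rightarrow> complex) \<Rightarrow> ('n \<Rightarrow> nat) \<Rightarrow> complex" where
  "reflect i d a \<gamma> = (if \<gamma> i \<le> d then (-1) ^ (d - \<gamma> i) * a (\<gamma>(i := d - \<gamma> i)) else 0)"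

lemma reflect_neq_0_iff: "reflect i d a \<gamma> \<noteq> 0 \<longleftrightarrow> \<gamma> i \<le> d \<and> a (\<gamma>(i := d - \<gamma> i)) \<noteq> 0"
  by (simp add: reflect_def)

text \<open>The map \<open>z \<mapsto> - 1 / z\<close> preserves the upper half-plane, and the
  factor \<open>z i ^ d\<close> that clears denominators is nonzero there.\<close>

lemma stable_reflect:
  assumes st: "stable a" and d: "\<And>\<gamma>. a \<gamma> \<noteq> 0 \<Longrightarrow> \<gamma> i \<le> d"
  shows "stable (reflect i d a)"
  unfolding stable_def
proof (intro conjI allI impI)
  have "{\<gamma>. reflect i d a \<gamma> \<noteq> 0} \<subseteq> (\<lambda>\<gamma>. \<gamma>(i := d - \<gamma> i)) ` {\<gamma>. a \<gamma> \<noteq> 0}"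
  proof
    fix \<gamma> assume "\<gamma> \<in> {\<gamma>. reflect i d a \<gamma> \<noteq> 0}"
    then have "\<gamma> i \<le> d" "\<gamma>(i := d - \<gamma> i) \<in> {\<gamma>. a \<gamma> \<noteq> 0}" by (simp_all add: reflect_neq_0_iff)
    then show "\<gamma> \<in> (\<lambda>\<gamma>. \<gamma>(i := d - \<gamma> i)) ` {\<gamma>. a \<gamma> \<noteq> 0}"
      by (intro image_eqI[of \<gamma> _ "\<gamma>(i := d - \<gamma> i)"]) simp_all
  qed
  then show "finite {\<gamma>. reflect i d a \<gamma> \<noteq> 0}"
    by (rule finite_subset) (use st in \<open>simp add: stable_def\<close>)
next
  fix z :: "'a \<Rightarrow> complex" assume z: "\<forall>i. Im (z i) > 0"
  define w where "w = - 1 / z i"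
  have zi: "z i \<noteq> 0" using z by (metis less_irrefl zero_complex.simps(2))
  have "Im w = Im (z i) / ((Re (z i))\<^sup>2 + (Im (z i))\<^sup>2)"
    unfolding w_def by (simp add: Im_divide)
  then have w: "Im w > 0" using z by (simp add: sum_power2_gt_zero_iff less_imp_neq[symmetric])
  have "mpeval (reflect i d a) z
      = (\<Sum>\<gamma> | reflect i d a \<gamma> \<noteq> 0. reflect i d a \<gamma> * (\<Prod>j\<in>UNIV. (z(i := z i)) j ^ \<gamma> j))"
    by (simp add: mpeval_def)
  also have "\<dots> = (\<Sum>\<gamma> | a \<gamma> \<noteq> 0. z i ^ d * (a \<gamma> * (\<Prod>j\<in>UNIV. (z(i := w)) j ^ \<gamma> j)))"
    unfolding prod_fun_upd_power
  proof (rule sum.reindex_bij_witness[where i = "\<lambda>\<gamma>. \<gamma>(i := d - \<gamma> i)" and j = "\<lambda>\<gamma>. \<gamma>(i := d - \<gamma> i)"])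
    fix \<gamma> assume "\<gamma> \<in> {\<gamma>. reflect i d a \<gamma> \<noteq> 0}"
    then have \<gamma>: "\<gamma> i \<le> d" by (simp add: reflect_neq_0_iff)
    have "(\<Prod>j\<in>-{i}. z j ^ (\<gamma>(i := d - \<gamma> i)) j) = (\<Prod>j\<in>-{i}. z j ^ \<gamma> j)"
      by (rule prod.cong) auto
    moreover have "z i ^ d * w ^ (d - \<gamma> i) = (-1) ^ (d - \<gamma> i) * z i ^ \<gamma> i"
    proof -
      have "z i ^ d = z i ^ (d - \<gamma> i) * z i ^ \<gamma> i" using \<gamma> by (simp flip: power_add)
      moreover have "(z i * w) ^ (d - \<gamma> i) = (-1) ^ (d - \<gamma> i)" using zi by (simp add: w_def)
      ultimately show ?thesis by (simp add: power_mult_distrib mult_ac)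
    qed
    ultimately show "z i ^ d * (a (\<gamma>(i := d - \<gamma> i)) * (w ^ (\<gamma>(i := d - \<gamma> i)) i *
        (\<Prod>j\<in>-{i}. z j ^ (\<gamma>(i := d - \<gamma> i)) j)))
      = reflect i d a \<gamma> * (z i ^ \<gamma> i * (\<Prod>j\<in>-{i}. z j ^ \<gamma> j))"
      using \<gamma> by (simp add: reflect_def mult_ac)
  qed (use d in \<open>auto simp: reflect_neq_0_iff\<close>)
  also have "\<dots> = z i ^ d * mpeval a (z(i := w))"
    by (simp add: mpeval_def sum_distrib_left)
  finally show "mpeval (reflect i d a) z \<noteq> 0"
    using st z w zi by (simp add: stable_def)
qed

section \<open>Cutting supports down to a box\<close>

text \<open>The empty set is included because derivatives of stable polynomials may vanish.\<close>

definition stable_support :: "('n::finite \<Rightarrow> nat) set \<Rightarrow> bool" where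
  "stable_support F \<longleftrightarrow> F = {} \<or> (\<exists>a. stable a \<and> F = {\<gamma>. a \<gamma> \<noteq> 0})"

lemma stable_support_Suc:
  assumes "stable_support F"
  shows "stable_support {\<gamma>. \<gamma>(i := Suc (\<gamma> i)) \<in> F}"
proof (cases "{\<gamma>. \<gamma>(i := Suc (\<gamma> i)) \<in> F} = {}")
  case True
  then show ?thesis by (simp add: stable_support_def)
next
  case False
  then obtain \<delta> where \<delta>: "\<delta>(i := Suc (\<delta> i)) \<in> F" by auto
  then obtain a where a: "stable a" "F = {\<gamma>. a \<gamma> \<noteq> 0}"
    using assms by (auto simp: stable_support_def)
  then have "stable (shift_deriv i a)"
    using \<delta> by (intro stable_shift_deriv[of _ _ \<delta>]) (auto simp: shift_deriv_eq_0_iff)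
  moreover have "{\<gamma>. \<gamma>(i := Suc (\<gamma> i)) \<in> F} = {\<gamma>. shift_deriv i a \<gamma> \<noteq> 0}"
    by (simp add: a shift_deriv_eq_0_iff)
  ultimately show ?thesis unfolding stable_support_def by blast
qed

lemma stable_support_shift:
  assumes "stable_support F"
  shows "stable_support {\<gamma>. \<gamma>(i := n + \<gamma> i) \<in> F}"
proof (induction n)
  case 0
  then show ?case using assms by simp
next
  case (Suc n)
  have "\<gamma>(i := Suc n + \<gamma> i) = (\<gamma>(i := Suc (\<gamma> i)))(i := n + (\<gamma>(i := Suc (\<gamma> i))) i)" for \<gamma> :: "'a \<Rightarrow> nat"
    by simp
  then show ?case using stable_support_Suc[OF Suc.IH, of i] by (simp only: mem_Collect_eq)
qed

lemma stable_support_reflect: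
  assumes "stable_support F" "\<And>\<gamma>. \<gamma> \<in> F \<Longrightarrow> \<gamma> i \<le> d"
  shows "stable_support {\<gamma>. \<gamma> i \<le> d \<and> \<gamma>(i := d - \<gamma> i) \<in> F}"
proof (cases "F = {}")
  case True
  then show ?thesis by (simp add: stable_support_def)
next
  case False
  then obtain a where a: "stable a" "F = {\<gamma>. a \<gamma> \<noteq> 0}"
    using assms by (auto simp: stable_support_def)
  then have "stable (reflect i d a)" using assms(2) by (auto intro: stable_reflect)
  moreover have "{\<gamma>. \<gamma> i \<le> d \<and> \<gamma>(i := d - \<gamma> i) \<in> F} = {\<gamma>. reflect i d a \<gamma> \<noteq> 0}"
    by (simp add: a reflect_neq_0_iff)
  ultimately show ?thesis unfolding stable_support_def by blast
qed

text \<open>Differentiating \<open>l\<close> times discards exponents below \<open>l\<close>.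
  Reflection brings the top exponents to the bottom, where \<open>d - m\<close> further derivatives
  discard those above \<open>l + m\<close>. The order of the remaining exponents is
  reversed.\<close>

lemma stable_support_truncate_reversed:
  assumes "stable_support F"
  shows "stable_support {\<gamma>. \<gamma> i \<le> m \<and> \<gamma>(i := l + (m - \<gamma> i)) \<in> F}"
proof -
  define G where "G = {\<gamma>. \<gamma>(i := l + \<gamma> i) \<in> F}"
  have G: "stable_support G" unfolding G_def using assms by (rule stable_support_shift)
  then have "finite G" by (auto simp: stable_support_def stable_def)
  \<comment> \<open>Large enough both to bound the exponents in \<open>G\<close> and to make
    \<open>d - m\<close> an exact subtraction.\<close>
  define d where "d = m + Max (insert 0 ((\<lambda>\<gamma>. \<gamma> i) ` G))"
  have "\<gamma> i \<le> d" if "\<gamma> \<in> G" for \<gamma>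
    unfolding d_def using that \<open>finite G\<close> by (intro trans_le_add2 Max_ge) auto
  then have "stable_support {\<gamma>. \<gamma> i \<le> d \<and> \<gamma>(i := d - \<gamma> i) \<in> G}"
    using G by (intro stable_support_reflect)
  from stable_support_shift[OF this, of i "d - m"]
  show ?thesis
  proof (rule back_subst[of stable_support])
    have "m \<le> d" by (simp add: d_def)
    then have "d - (d - m + k) = m - k" "d - m + k \<le> d \<longleftrightarrow> k \<le> m" for k by auto
    then show "{\<gamma>. \<gamma>(i := d - m + \<gamma> i) \<in> {\<gamma>. \<gamma> i \<le> d \<and> \<gamma>(i := d - \<gamma> i) \<in> G}}
        = {\<gamma>. \<gamma> i \<le> m \<and> \<gamma>(i := l + (m - \<gamma> i)) \<in> F}"
      by (simp add: G_def)
  qed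
qed

text \<open>A second reflection, now at \<open>m\<close>, undoes the reversal.\<close>

lemma stable_support_truncate:
  assumes "stable_support F"
  shows "stable_support {\<gamma>. \<gamma> i \<le> m \<and> \<gamma>(i := l + \<gamma> i) \<in> F}"
proof -
  have "stable_support {\<gamma>. \<gamma> i \<le> m \<and> \<gamma>(i := m - \<gamma> i) \<in> {\<gamma>. \<gamma> i \<le> m \<and> \<gamma>(i := l + (m - \<gamma> i)) \<in> F}}"
    by (intro stable_support_reflect stable_support_truncate_reversed assms) auto
  moreover have "{\<gamma>. \<gamma> i \<le> m \<and> \<gamma>(i := m - \<gamma> i) \<in> {\<gamma>. \<gamma> i \<le> m \<and> \<gamma>(i := l + (m - \<gamma> i)) \<in> F}}
      = {\<gamma>. \<gamma> i \<le> m \<and> \<gamma>(i := l + \<gamma> i) \<in> F}"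
    by auto
  ultimately show ?thesis by simp
qed

text \<open>Only meant for \<open>k \<le> \<bar>x - y\<bar>\<close>, where the truncated subtraction is exact.\<close>

definition toward :: "nat \<Rightarrow> nat \<Rightarrow> nat \<Rightarrow> nat" where
  "toward x y k = (if x \<le> y then x + k else x - k)"

definition nat_dist :: "nat \<Rightarrow> nat \<Rightarrow> nat" where
  "nat_dist x y = (if x \<le> y then y - x else x - y)"

text \<open>Going up from \<open>x\<close> is plain truncation; going down is the reversed one with
  lower end \<open>y\<close>.\<close>

lemma stable_support_truncate_toward:
  assumes "stable_support F"
  shows "stable_support {\<gamma>. \<gamma> i \<le> nat_dist x y \<and> \<gamma>(i := toward x y (\<gamma> i)) \<in> F}"
proof (cases "x \<le> y")
  case True
  then show ?thesis
    using stable_support_truncate[OF assms, of i "y - x" x] by (simp add: toward_def nat_dist_def)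
next
  case False
  then have "{\<gamma>. \<gamma> i \<le> x - y \<and> \<gamma>(i := y + (x - y - \<gamma> i)) \<in> F}
      = {\<gamma>. \<gamma> i \<le> x - y \<and> \<gamma>(i := x - \<gamma> i) \<in> F}"
    by (intro Collect_cong conj_cong refl arg_cong[of _ _ "\<lambda>\<gamma>. \<gamma> \<in> F"]) auto
  then show ?thesis
    using stable_support_truncate_reversed[OF assms, of i "x - y" y] False
    by (simp add: toward_def nat_dist_def)
qed

text \<open>The coordinates are treated one by one; those outside \<open>A\<close> still carry the
  original exponents. In the new coordinates \<open>\<alpha>\<close> sits at the origin.\<close>

lemma stable_support_box:
  fixes \<alpha> \<beta> :: "'n::finite \<Rightarrow> nat"
  assumes "stable_support F"
  shows "stable_support {\<gamma>. (\<forall>i. \<gamma> i \<le> nat_dist (\<alpha> i) (\<beta> i)) \<and> (\<lambda>i. toward (\<alpha> i) (\<beta> i) (\<gamma> i)) \<in> F}"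
proof -
  have "stable_support {\<gamma>. (\<forall>i\<in>A. \<gamma> i \<le> nat_dist (\<alpha> i) (\<beta> i)) \<and>
      (\<lambda>i. if i \<in> A then toward (\<alpha> i) (\<beta> i) (\<gamma> i) else \<gamma> i) \<in> F}" if "finite A" for A
    using that
  proof (induction A rule: finite_induct)
    case empty
    then show ?case using assms by simp
  next
    case (insert p A)
    have upd: "(\<lambda>i. if i \<in> A then toward (\<alpha> i) (\<beta> i) ((\<gamma>(p := c)) i) else (\<gamma>(p := c)) i)
        = (\<lambda>i. if i \<in> A then toward (\<alpha> i) (\<beta> i) (\<gamma> i) else if i = p then c else \<gamma> i)" for \<gamma> c
      using insert.hyps by auto
    have eq: "(\<lambda>i. if i \<in> insert p A then toward (\<alpha> i) (\<beta> i) (\<gamma> i) else \<gamma> i)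
        = (\<lambda>i. if i \<in> A then toward (\<alpha> i) (\<beta> i) (\<gamma> i)
             else if i = p then toward (\<alpha> p) (\<beta> p) (\<gamma> p) else \<gamma> i)" for \<gamma>
      using insert.hyps by auto
    have ball: "(\<forall>i\<in>A. (\<gamma>(p := c)) i \<le> nat_dist (\<alpha> i) (\<beta> i)) \<longleftrightarrow> (\<forall>i\<in>A. \<gamma> i \<le> nat_dist (\<alpha> i) (\<beta> i))" for \<gamma> c
      using insert.hyps by auto
    from stable_support_truncate_toward[OF insert.IH, of p "\<alpha> p" "\<beta> p"]
    show ?case
      unfolding mem_Collect_eq upd eq ball by (simp add: conj_assoc)
  qed
  from this[of UNIV] show ?thesis by simp
qed

text \<open>Box coordinates move \<open>\<alpha>\<close> to 0 and \<open>\<beta>\<close> to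
  \<open>m\<close>, which reduces the claim to the exchange at the origin.\<close>

lemma stable_support_exchange:
  assumes F: "stable_support F" "\<alpha> \<in> F" "\<beta> \<in> F" and p: "\<alpha> p \<noteq> \<beta> p"
    and nmem: "\<alpha>(p := toward (\<alpha> p) (\<beta> p) 1) \<notin> F"
  defines "\<delta> \<equiv> \<alpha>(p := toward (\<alpha> p) (\<beta> p) 1)"
  shows "\<exists>j. \<delta> j \<noteq> \<beta> j \<and> \<delta>(j := toward (\<delta> j) (\<beta> j) 1) \<in> F"
proof -
  define T where "T \<gamma> = (\<lambda>i. toward (\<alpha> i) (\<beta> i) (\<gamma> i))" for \<gamma>
  define m where "m = (\<lambda>i. nat_dist (\<alpha> i) (\<beta> i))"
  define G where "G = {\<gamma>. (\<forall>i. \<gamma> i \<le> m i) \<and> T \<gamma> \<in> F}"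
  have "stable_support G"
    unfolding G_def m_def T_def using F(1) by (rule stable_support_box)
  moreover have G0: "(\<lambda>_. 0) \<in> G"
    using F(2) by (simp add: G_def T_def toward_def cong: if_cong)
  ultimately obtain a where a: "stable a" "G = {\<gamma>. a \<gamma> \<noteq> 0}"
    by (auto simp: stable_support_def)
  have "T m = \<beta>" by (auto simp: T_def m_def toward_def nat_dist_def)
  then have "m \<in> G" using F(3) by (simp add: G_def)
  have mp: "m p \<noteq> 0" using p by (simp add: m_def nat_dist_def)
  have T1: "T ((\<lambda>_. 0)(p := 1)) = \<delta>" by (auto simp: T_def \<delta>_def toward_def)
  then have "(\<lambda>_. 0)(p := 1) \<notin> G" using nmem by (simp add: G_def \<delta>_def)
  then have "\<exists>j. ((\<lambda>_. 0)(p := 1))(j := Suc (((\<lambda>_. 0)(p := 1)) j)) \<in> G"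
    using stable_exchange_from_0[OF a(1), of m p] G0 \<open>m \<in> G\<close> mp by (simp add: a(2))
  then obtain j where j: "((\<lambda>_. 0)(p := 1))(j := Suc (((\<lambda>_. 0)(p := 1)) j)) \<in> G" (is "?e \<in> G") by blast
  \<comment> \<open>The box bound is what makes the second step lead toward \<open>\<beta>\<close>:
    repeating \<open>p\<close> requires distance at least 2 there, any other \<open>j\<close>
    distance at least 1.\<close>
  have le: "?e j \<le> m j" and mem: "T ?e \<in> F" using j unfolding G_def mem_Collect_eq by blast+
  have "T ?e = \<delta>(j := toward (\<delta> j) (\<beta> j) 1) \<and> \<delta> j \<noteq> \<beta> j"
  proof (cases "j = p")
    case True
    then have "2 \<le> m p" using le by simp
    then show ?thesis using True
      by (auto simp: T_def \<delta>_def toward_def m_def nat_dist_def fun_eq_iff split: if_splits)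
  next
    case False
    then have "1 \<le> m j" using le by simp
    then show ?thesis using False
      by (auto simp: T_def \<delta>_def toward_def m_def nat_dist_def fun_eq_iff split: if_splits)
  qed
  then show ?thesis using mem by auto
qed

section \<open>Steps between integer vectors\<close>

lemma l1_norm_eq_1:
  assumes "l1_norm \<sigma> = 1"
  obtains p s where "\<sigma> = axis p s" "\<bar>s\<bar> = 1"
proof -
  have "\<sigma> \<noteq> 0" using assms by (auto simp: l1_norm_def)
  then obtain p where p: "\<sigma> $ p \<noteq> 0" by (auto simp: vec_eq_iff)
  have "l1_norm \<sigma> = \<bar>\<sigma> $ p\<bar> + (\<Sum>i\<in>UNIV - {p}. \<bar>\<sigma> $ i\<bar>)"
    unfolding l1_norm_def by (rule sum.remove) auto
  moreover have "(\<Sum>i\<in>UNIV - {p}. \<bar>\<sigma> $ i\<bar>) \<ge> 0" by (rule sum_nonneg) auto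
  ultimately have "\<bar>\<sigma> $ p\<bar> = 1" and "(\<Sum>i\<in>UNIV - {p}. \<bar>\<sigma> $ i\<bar>) = 0"
    using assms p by linarith+
  then have "\<sigma> = axis p (\<sigma> $ p)"
    by (auto simp: vec_eq_iff axis_def sum_nonneg_eq_0_iff)
  then show thesis using that \<open>\<bar>\<sigma> $ p\<bar> = 1\<close> by blast
qed

lemma l1_norm_add_axis:
  "l1_norm (x + axis p s) = l1_norm x + \<bar>x $ p + s\<bar> - \<bar>x $ p\<bar>"
proof -
  have "l1_norm (x + axis p s) = \<bar>x $ p + s\<bar> + (\<Sum>i\<in>UNIV - {p}. \<bar>(x + axis p s) $ i\<bar>)"
    unfolding l1_norm_def by (subst sum.remove[of _ p]) (auto simp: axis_def)
  also have "(\<Sum>i\<in>UNIV - {p}. \<bar>(x + axis p s) $ i\<bar>) = (\<Sum>i\<in>UNIV - {p}. \<bar>x $ i\<bar>)"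
    by (rule sum.cong) (auto simp: axis_def)
  also have "\<dots> = l1_norm x - \<bar>x $ p\<bar>"
    unfolding l1_norm_def by (simp add: sum.remove[of UNIV p])
  finally show ?thesis by simp
qed

lemma l1_norm_axis: "l1_norm (axis p s) = \<bar>s\<bar>"
  using l1_norm_add_axis[of 0 p s] by (simp add: l1_norm_def)

text \<open>An integer vector of norm 1 is a signed unit vector. Adding it changes one coordinate of
  \<open>\<alpha> - \<beta>\<close>, and the norm drops exactly when the sign points toward
  \<open>\<beta>\<close>.\<close>

lemma steps_iff:
  "\<sigma> \<in> steps \<alpha> \<beta> \<longleftrightarrow> (\<exists>p. \<alpha> $ p \<noteq> \<beta> $ p \<and> \<sigma> = axis p (sgn (\<beta> $ p - \<alpha> $ p)))"
proof
  assume \<sigma>: "\<sigma> \<in> steps \<alpha> \<beta>"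
  then obtain p s where ps: "\<sigma> = axis p s" "\<bar>s\<bar> = 1"
    using l1_norm_eq_1 by (auto simp: steps_def)
  have "l1_norm (\<alpha> - \<beta> + axis p s) = l1_norm (\<alpha> - \<beta>) - 1"
    using \<sigma> ps by (simp add: steps_def algebra_simps)
  then have "\<bar>\<alpha> $ p - \<beta> $ p + s\<bar> = \<bar>\<alpha> $ p - \<beta> $ p\<bar> - 1"
    by (simp add: l1_norm_add_axis)
  then have "\<alpha> $ p \<noteq> \<beta> $ p" "s = sgn (\<beta> $ p - \<alpha> $ p)"
    using ps(2) by (auto simp: sgn_if)
  then show "\<exists>p. \<alpha> $ p \<noteq> \<beta> $ p \<and> \<sigma> = axis p (sgn (\<beta> $ p - \<alpha> $ p))"
    using ps(1) by auto
next
  assume "\<exists>p. \<alpha> $ p \<noteq> \<beta> $ p \<and> \<sigma> = axis p (sgn (\<beta> $ p - \<alpha> $ p))"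
  then obtain p where p: "\<alpha> $ p \<noteq> \<beta> $ p" "\<sigma> = axis p (sgn (\<beta> $ p - \<alpha> $ p))" by blast
  have "l1_norm (\<alpha> - \<beta> + \<sigma>) = l1_norm (\<alpha> - \<beta>) - 1"
    using p by (simp add: l1_norm_add_axis) (auto simp: sgn_if)
  moreover have "\<alpha> - \<beta> + \<sigma> = \<alpha> + \<sigma> - \<beta>" by simp
  moreover have "l1_norm \<sigma> = 1" using p by (simp add: l1_norm_axis abs_sgn_eq)
  ultimately show "\<sigma> \<in> steps \<alpha> \<beta>" by (simp only: steps_def mem_Collect_eq)
qed

text \<open>A downward step starts above \<open>\<beta> $ p \<ge> 0\<close>, so subtracting 1 in
  \<open>nat\<close> is exact.\<close>

lemma int_vec_add_step:
  assumes "\<alpha> $ p \<noteq> \<beta> $ p"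
  shows "int_vec \<alpha> + axis p (sgn (int_vec \<beta> $ p - int_vec \<alpha> $ p))
    = int_vec (vec_lambda ((vec_nth \<alpha>)(p := toward (\<alpha> $ p) (\<beta> $ p) 1)))"
  using assms by (auto simp: vec_eq_iff int_vec_def axis_def toward_def sgn_if of_nat_diff)

section \<open>Rotation to the upper half-plane and conclusion\<close>

text \<open>Replacing \<open>z\<close> by \<open>\<omega> * z\<close> multiplies each coefficient by
  a power of \<open>\<omega> \<noteq> 0\<close> and so keeps the support.\<close>

lemma stable_support_vec_keys:
  fixes f :: "'n::finite cpoly"
  assumes "half_plane_property f"
  shows "stable_support {\<gamma>. vec_lambda \<gamma> \<in> Poly_Mapping.keys f}"
proof -
  obtain a b where a: "a \<noteq> 0" and fr: "0 \<in> frontier {z::complex. inner a z < b}"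
    and st: "H_stable {z. inner a z < b} f"
    using assms by (auto simp: half_plane_property_def open_half_plane_def)
  have b: "b = 0" using fr a by (simp add: frontier_halfspace_lt)
  \<comment> \<open>Chosen so that \<open>inner a (\<omega> * w) = - Im w\<close>: multiplication by
    \<open>\<omega>\<close> carries the upper half-plane onto the given one.\<close>
  define \<omega> where "\<omega> = \<i> / cnj a"
  have \<omega>: "\<omega> \<noteq> 0" using a by (simp add: \<omega>_def)
  define c where "c \<gamma> = Poly_Mapping.lookup f (vec_lambda \<gamma>) * \<omega> ^ (\<Sum>i\<in>UNIV. \<gamma> i)" for \<gamma> :: "'n \<Rightarrow> nat"
  have supp: "{\<gamma>. c \<gamma> \<noteq> 0} = {\<gamma>. vec_lambda \<gamma> \<in> Poly_Mapping.keys f}"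
    using \<omega> by (auto simp: c_def in_keys_iff)
  also have img: "\<dots> = vec_nth ` Poly_Mapping.keys f"
    by (auto simp: image_iff) (metis vec_lambda_inverse UNIV_I)
  finally have fin: "finite {\<gamma>. c \<gamma> \<noteq> 0}" by simp
  have "mpeval c z = poly_eval f (\<chi> i. \<omega> * z i)" for z
  proof -
    have "mpeval c z = (\<Sum>\<gamma>\<in>vec_nth ` Poly_Mapping.keys f. c \<gamma> * (\<Prod>i\<in>UNIV. z i ^ \<gamma> i))"
      unfolding mpeval_def supp img ..
    also have "\<dots> = (\<Sum>\<alpha>\<in>Poly_Mapping.keys f. c (vec_nth \<alpha>) * (\<Prod>i\<in>UNIV. z i ^ \<alpha> $ i))"
      by (rule sum.reindex[unfolded o_def]) (simp add: inj_on_def vec_nth_inject)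
    also have "\<dots> = poly_eval f (\<chi> i. \<omega> * z i)"
      unfolding poly_eval_def monomial_eval_def c_def
      by (simp add: power_mult_distrib prod.distrib power_sum mult_ac vec_nth_inverse)
    finally show ?thesis .
  qed
  moreover have "inner a (\<omega> * w) < 0" if "Im w > 0" for w
  proof -
    have "inner a (\<omega> * w) = Re (cnj a * (\<omega> * w))" by (simp add: inner_complex_def)
    also have "cnj a * (\<omega> * w) = \<i> * w" using a by (simp add: \<omega>_def)
    finally show ?thesis using that by simp
  qed
  ultimately have "stable c"
    using fin st by (auto simp: stable_def H_stable_def b)
  then show ?thesis
    unfolding stable_support_def using supp by blast
qed

theorem theorem3p2:
  fixes f :: "'n::finite cpoly"
  assumes "half_plane_property f"
  shows "jump_system (int_vec ` Poly_Mapping.keys f)"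
  unfolding jump_system_def
proof (intro ballI impI)
  let ?K = "Poly_Mapping.keys f"
  fix x y \<sigma>
  assume "x \<in> int_vec ` ?K" "y \<in> int_vec ` ?K" and \<sigma>: "\<sigma> \<in> steps x y" and nmem: "x + \<sigma> \<notin> int_vec ` ?K"
  then obtain \<alpha> \<beta> where \<alpha>: "\<alpha> \<in> ?K" "x = int_vec \<alpha>" and \<beta>: "\<beta> \<in> ?K" "y = int_vec \<beta>" by blast
  obtain p where p: "\<alpha> $ p \<noteq> \<beta> $ p" and \<sigma>p: "\<sigma> = axis p (sgn (y $ p - x $ p))"
    using \<sigma> by (auto simp: steps_iff \<alpha> \<beta> int_vec_def)
  define \<delta> where "\<delta> = vec_lambda ((vec_nth \<alpha>)(p := toward (\<alpha> $ p) (\<beta> $ p) 1))"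
  have x\<sigma>: "x + \<sigma> = int_vec \<delta>"
    unfolding \<sigma>p \<alpha> \<beta> \<delta>_def using p by (rule int_vec_add_step)
  have nmem': "\<delta> \<notin> ?K" using nmem x\<sigma> by auto
  have \<delta>_nth: "vec_nth \<delta> = (vec_nth \<alpha>)(p := toward (\<alpha> $ p) (\<beta> $ p) 1)"
    by (simp add: \<delta>_def fun_eq_iff)
  \<comment> \<open>The exchange property on exponent functions supplies the coordinate
    \<open>j\<close> of the second step; its sign is then the one toward
    \<open>\<beta>\<close>.\<close>
  have "\<exists>j. vec_nth \<delta> j \<noteq> \<beta> $ j \<and> (vec_nth \<delta>)(j := toward (\<delta> $ j) (\<beta> $ j) 1) \<in> {\<gamma>. vec_lambda \<gamma> \<in> ?K}"
    unfolding \<delta>_nth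
    by (rule stable_support_exchange[OF stable_support_vec_keys[OF assms]])
      (use \<alpha> \<beta> p nmem' in \<open>simp_all add: \<delta>_def vec_nth_inverse\<close>)
  then obtain j where j: "\<delta> $ j \<noteq> \<beta> $ j"
    "vec_lambda ((vec_nth \<delta>)(j := toward (\<delta> $ j) (\<beta> $ j) 1)) \<in> ?K" by auto
  define \<tau> where "\<tau> = axis j (sgn (int_vec \<beta> $ j - int_vec \<delta> $ j))"
  have "\<tau> \<in> steps (x + \<sigma>) y"
    unfolding steps_iff x\<sigma> \<beta> \<tau>_def using j(1) by (auto simp: int_vec_def)
  moreover have "x + \<sigma> + \<tau> \<in> int_vec ` ?K"
    unfolding x\<sigma> \<tau>_def int_vec_add_step[OF j(1)] using j(2) by blast
  ultimately show "\<exists>\<tau>\<in>steps (x + \<sigma>) y. x + \<sigma> + \<tau> \<in> int_vec ` ?K" by blast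
qed

end
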